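(* Let $R$ be a commutative ring with identity and let $(G,\alpha)$ be a finite edge-labeled graph. Fix any subgraph $G'$ of $G$ and let $\mathbf{p}$ be a generalized spline for $(G',\alpha|_{G'})$. Let $S$ be the set of edges $v_iv_j$ of $G$ that are not edges of $G'$ and that satisfy $v_i\in V(G')$ or $v_j\in V(G')$. For each $v_iv_j\in S$ let $\alpha_{i,j}$ be a nonzero element of the ideal $\alpha(v_iv_j)$, and let $N_{G'}=\prod_{v_iv_j\in S}\alpha_{i,j}$. Then the vector $\mathbf{q}\in\bigoplus_{v\in V(G)}R$ defined by $$\mathbf{q}_{v_i}=\begin{cases}N_{G'}\,\mathbf{p}_{v_i}&\text{if }v_i\in V(G'),\\ 0&\text{if }v_i\notin V(G')\end{cases}$$ is a generalized spline for $G$.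
   Context: All graphs are finite, with no multiple edges, and edges join distinct vertices. An edge-labeling function on a graph $G=(V,E)$ is a map $\alpha$ from $E$ to the nonzero ideals of $R$; $\alpha|_{G'}$ is its restriction to $E(G')$. A generalized spline for $(G,\alpha)$ is an element $\mathbf{p}\in\bigoplus_{v\in V}R$ with $\mathbf{p}_u-\mathbf{p}_v\in\alpha(uv)$ for every edge $uv\in E$. An empty product equals $1$. *)

theory Defs
  imports "HOL-Algebra.Algebra"
begin

text \<open>
  An edge joining \<open>u\<close> and \<open>v\<close> is the unordered pair \<open>{u, v}\<close>; collecting edges in a set
  rules out multiple edges, and \<open>u \<noteq> v\<close> rules out loops.
\<close>

record 'v graph =
  verts :: "'v set"
  edges :: "'v set set"

definition simple_graph :: "'v graph \<Rightarrow> bool" where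
  "simple_graph G \<longleftrightarrow>
     finite (verts G) \<and>
     edges G \<subseteq> {{u, v} | u v. u \<in> verts G \<and> v \<in> verts G \<and> u \<noteq> v}"

definition subgraph :: "'v graph \<Rightarrow> 'v graph \<Rightarrow> bool" where
  "subgraph H G \<longleftrightarrow>
     simple_graph H \<and> verts H \<subseteq> verts G \<and> edges H \<subseteq> edges G"

definition edge_labeling ::
    "('r, 'm) ring_scheme \<Rightarrow> 'v graph \<Rightarrow> ('v set \<Rightarrow> 'r set) \<Rightarrow> bool" where
  "edge_labeling R G \<alpha> \<longleftrightarrow> \<alpha> \<in> edges G \<rightarrow> {I. ideal I R \<and> I \<noteq> {\<zero>\<^bsub>R\<^esub>}}"

text \<open>
  As vertex sets are finite, the direct sum of copies of \<open>R\<close> indexed by \<open>verts G\<close> is the set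
  of all functions from \<open>verts G\<close> to \<open>carrier R\<close>.
\<close>

definition generalized_spline ::
    "('r, 'm) ring_scheme \<Rightarrow> 'v graph \<Rightarrow> ('v set \<Rightarrow> 'r set) \<Rightarrow> ('v \<Rightarrow> 'r) \<Rightarrow> bool" where
  "generalized_spline R G \<alpha> p \<longleftrightarrow>
     p \<in> verts G \<rightarrow>\<^sub>E carrier R \<and>
     (\<forall>u v. {u, v} \<in> edges G \<longrightarrow> p u \<ominus>\<^bsub>R\<^esub> p v \<in> \<alpha> {u, v})"

definition outer_incident_edges :: "'v graph \<Rightarrow> 'v graph \<Rightarrow> 'v set set" where
  "outer_incident_edges G H =
     {{u, v} | u v. {u, v} \<in> edges G \<and> {u, v} \<notin> edges H \<and> (u \<in> verts H \<or> v \<in> verts H)}"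

end

theory Submission
  imports Defs
begin

text \<open>
  Along an edge of \<open>G'\<close>, multiplying the spline condition by \<open>N\<close> stays in the ideal. Every other
  edge of \<open>G\<close> that meets \<open>G'\<close> contributes a factor to \<open>N\<close>, so \<open>N\<close> lies in its ideal and the values
  at both ends do so already. At the remaining edges both values vanish.
\<close>

text \<open>Splitting off the factor at \<open>e\<close> leaves a product that is a ring element,
  and \<open>I\<close> absorbs multiplication by it.\<close>

lemma (in cring) finprod_in_ideal:
  assumes "ideal I R" "finite A" "f \<in> A \<rightarrow> carrier R" "e \<in> A" "f e \<in> I"
  shows "(\<Otimes>x\<in>A. f x) \<in> I"
proof -
  have "(\<Otimes>x\<in>A. f x) = (\<Otimes>x\<in>insert e (A - {e}). f x)"
    using assms(4) by (simp add: insert_absorb)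
  also have "\<dots> = f e \<otimes> (\<Otimes>x\<in>A - {e}. f x)"
    using assms by (subst finprod_insert) auto
  also have "\<dots> \<in> I"
    using assms by (intro ideal.I_r_closed finprod_closed) auto
  finally show ?thesis .
qed

lemma (in ideal) minus_closed:
  assumes "x \<in> I" "y \<in> I"
  shows "x \<ominus> y \<in> I"
  using assms by (simp add: a_minus_def)

lemma simple_graph_finite_edges:
  assumes "simple_graph G"
  shows "finite (edges G)"
proof (rule finite_subset)
  show "edges G \<subseteq> Pow (verts G)"
    using assms by (auto simp: simple_graph_def)
  show "finite (Pow (verts G))"
    using assms by (simp add: simple_graph_def)
qed

text \<open>The pair provided by \<open>simple_graph\<close> agrees with \<open>{u, v}\<close> only
  up to order, so both matchings have to be considered.\<close>

lemma simple_graph_edge_verts: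
  assumes "simple_graph G" "{u, v} \<in> edges G"
  shows "u \<in> verts G" "v \<in> verts G"
proof -
  obtain x y where "{u, v} = {x, y}" "x \<in> verts G" "y \<in> verts G"
    using assms unfolding simple_graph_def by blast
  then show "u \<in> verts G" "v \<in> verts G"
    by (auto simp: doubleton_eq_iff)
qed

theorem theorem5p1:
  fixes R :: "('r, 'm) ring_scheme"
    and G G' :: "'v graph"
    and \<alpha> :: "'v set \<Rightarrow> 'r set"
    and p :: "'v \<Rightarrow> 'r"
    and S :: "'v set set"
    and a :: "'v set \<Rightarrow> 'r"
    and N :: 'r
  assumes "cring R"
    and "simple_graph G"
    and "edge_labeling R G \<alpha>"
    and "subgraph G' G"
    and "generalized_spline R G' (restrict \<alpha> (edges G')) p"
    and "S = outer_incident_edges G G'"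
    and "\<forall>e\<in>S. a e \<in> \<alpha> e \<and> a e \<noteq> \<zero>\<^bsub>R\<^esub>"
    and "N = (\<Otimes>\<^bsub>R\<^esub>e\<in>S. a e)"
  shows "generalized_spline R G \<alpha>
           (\<lambda>v\<in>verts G. if v \<in> verts G' then N \<otimes>\<^bsub>R\<^esub> p v else \<zero>\<^bsub>R\<^esub>)"
proof -
  interpret cring R by fact
  let ?q = "\<lambda>v. if v \<in> verts G' then N \<otimes>\<^bsub>R\<^esub> p v else \<zero>\<^bsub>R\<^esub>"
  have G': "simple_graph G'"
    using assms(4) by (simp add: subgraph_def)
  have p_carrier: "p v \<in> carrier R" if "v \<in> verts G'" for v
    using assms(5) that by (auto simp: generalized_spline_def)
  have S_edges: "S \<subseteq> edges G"
    using assms(6) by (auto simp: outer_incident_edges_def)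
  have ideal: "ideal (\<alpha> e) R" if "e \<in> edges G" for e
    using assms(3) that by (auto simp: edge_labeling_def)
  have a_carrier: "a \<in> S \<rightarrow> carrier R"
    using assms(7) S_edges ideal by (blast intro: additive_subgroup.a_Hcarr ideal.axioms(1))
  then have N_carrier: "N \<in> carrier R"
    unfolding assms(8) by (rule finprod_closed)
  \<comment> \<open>Finiteness of \<open>S\<close>, inherited from \<open>edges G\<close>, is
    essential here: over an infinite set \<open>finprod\<close> defaults to
    \<open>\<one>\<close>.\<close>
  have N_ideal: "N \<in> \<alpha> e" if "e \<in> S" for e
    unfolding assms(8)
    using that S_edges assms(2,7) a_carrier
    by (intro finprod_in_ideal[of _ _ _ e] ideal)
       (auto intro: finite_subset simple_graph_finite_edges)
  have "?q u \<ominus>\<^bsub>R\<^esub> ?q v \<in> \<alpha> {u, v}" if e: "{u, v} \<in> edges G" for u v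
  proof -
    interpret I: ideal "\<alpha> {u, v}" R
      using e by (rule ideal)
    \<comment> \<open>An edge outside both \<open>edges G'\<close> and \<open>S\<close> has no end
      in \<open>G'\<close>, by the definition of \<open>S\<close>.\<close>
    consider (inner) "{u, v} \<in> edges G'" | (outer) "{u, v} \<in> S"
      | (disjoint) "u \<notin> verts G'" "v \<notin> verts G'"
      using e unfolding assms(6) outer_incident_edges_def by blast
    then show ?thesis
    proof cases
      case inner
      have "p u \<ominus>\<^bsub>R\<^esub> p v \<in> \<alpha> {u, v}"
        using assms(5) inner by (auto simp: generalized_spline_def)
      then have "N \<otimes>\<^bsub>R\<^esub> (p u \<ominus>\<^bsub>R\<^esub> p v) \<in> \<alpha> {u, v}"
        using N_carrier by (rule I.I_l_closed)
      \<comment> \<open>Both ends lie in \<open>G'\<close>, so \<open>?q\<close> takes its first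
        branch twice and distributivity gives the difference.\<close>
      then show ?thesis
        using simple_graph_edge_verts[OF G' inner] p_carrier N_carrier
        by (simp add: a_minus_def r_distr r_minus)
    next
      case outer
      \<comment> \<open>Taking \<open>w\<close> arbitrary avoids asking which end lies in
        \<open>G'\<close>: the value is a multiple of \<open>N\<close> or zero.\<close>
      then have "?q w \<in> \<alpha> {u, v}" for w
        using N_ideal p_carrier by (simp add: I.I_r_closed)
      then show ?thesis
        by (intro I.minus_closed)
    next
      case disjoint
      then show ?thesis
        by (simp add: a_minus_def)
    qed
  qed
  \<comment> \<open>Edges of \<open>G\<close> have their ends in \<open>verts G\<close>, where the
    restricted function agrees with \<open>?q\<close>.\<close>
  then show ?thesis
    using simple_graph_edge_verts[OF assms(2)] p_carrier N_carrier
    unfolding generalized_spline_def by auto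
qed

end
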